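(* The satisfaction systems $\Lambda_{K3}$ (Kleene's 3-valued logic) and $\Lambda_{P3}$ (Priest's 3-valued logic) are both reception-compatible; moreover $\Lambda_{K3}$ is eviction-compatible, while $\Lambda_{P3}$ is not eviction-compatible.
   Context: Fix a finite set $\mathcal{P}$ of propositional atoms and let $\mathcal{L}_{\mathrm{Prop}}$ be the propositional language over $\mathcal{P}$ with connectives $\neg,\wedge,\vee$. Consider truth values $f<u<t$ (false, unknown, true). $\mathfrak{M}_3$ is the set of functions $v:\mathcal{L}_{\mathrm{Prop}}\to\{f,u,t\}$ with $v(\neg\varphi)=t,u,f$ when $v(\varphi)=f,u,t$ respectively, $v(\varphi\wedge\psi)=\min(v(\varphi),v(\psi))$, $v(\varphi\vee\psi)=\max(v(\varphi),v(\psi))$. $\Lambda_{K3}=(\mathcal{L}_{\mathrm{Prop}},\mathfrak{M}_3,\models_{K3})$ where $v\models_{K3}B$ iff $v(\varphi)=t$ for all $\varphi\in B$; $\Lambda_{P3}=(\mathcal{L}_{\mathrm{Prop}},\mathfrak{M}_3,\models_{P3})$ where $v\models_{P3}B$ iff $v(\varphi)\in\{t,u\}$ for all $\varphi\in B$. For a satisfaction system $\Lambda=(\mathcal{L},\mathfrak{M},\models)$: $\mathrm{Mod}(B)=\{m\in\mathfrak{M}\mid m\models B\}$; $\mathrm{FR}(\Lambda)=\{\mathrm{Mod}(B)\mid B\subseteq\mathcal{L}$ finite$\}$; $\mathrm{FRsubs}(\mathbb{M},\Lambda)$ is the set of $\subseteq$-maximal elements of $\{X\in\mathrm{FR}(\Lambda)\mid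 X\subseteq\mathbb{M}\}$ and $\mathrm{FRsups}(\mathbb{M},\Lambda)$ the set of $\subseteq$-minimal elements of $\{X\in\mathrm{FR}(\Lambda)\mid\mathbb{M}\subseteq X\}$. $\Lambda$ is eviction-compatible if $\mathrm{FRsubs}(\mathrm{Mod}(B)\setminus\mathbb{M},\Lambda)\neq\emptyset$ for all finite $B\subseteq\mathcal{L}$ and $\mathbb{M}\subseteq\mathfrak{M}$; it is reception-compatible if $\mathrm{FRsups}(\mathrm{Mod}(B)\cup\mathbb{M},\Lambda)\neq\emptyset$ for all finite $B$ and $\mathbb{M}$. *)

theory Defs
  imports Main
begin

record ('f, 'm) satsys =
  lang :: "'f set"
  models :: "'m set"
  satisfies :: "'m \<Rightarrow> 'f set \<Rightarrow> bool"

definition Mod :: "('f, 'm) satsys \<Rightarrow> 'f set \<Rightarrow> 'm set" where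
  "Mod \<Lambda> B = {m \<in> models \<Lambda>. satisfies \<Lambda> m B}"

definition FR :: "('f, 'm) satsys \<Rightarrow> 'm set set" where
  "FR \<Lambda> = {Mod \<Lambda> B | B. B \<subseteq> lang \<Lambda> \<and> finite B}"

definition FRsubs :: "'m set \<Rightarrow> ('f, 'm) satsys \<Rightarrow> 'm set set" where
  "FRsubs M \<Lambda> = {X \<in> FR \<Lambda>. X \<subseteq> M \<and> \<not> (\<exists>Y \<in> FR \<Lambda>. Y \<subseteq> M \<and> X \<subset> Y)}"

definition FRsups :: "'m set \<Rightarrow> ('f, 'm) satsys \<Rightarrow> 'm set set" where
  "FRsups M \<Lambda> = {X \<in> FR \<Lambda>. M \<subseteq> X \<and> \<not> (\<exists>Y \<in> FR \<Lambda>. M \<subseteq> Y \<and> Y \<subset> X)}"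

definition eviction_compatible :: "('f, 'm) satsys \<Rightarrow> bool" where
  "eviction_compatible \<Lambda> \<longleftrightarrow>
    (\<forall>B M. finite B \<and> B \<subseteq> lang \<Lambda> \<and> M \<subseteq> models \<Lambda> \<longrightarrow> FRsubs (Mod \<Lambda> B - M) \<Lambda> \<noteq> {})"

definition reception_compatible :: "('f, 'm) satsys \<Rightarrow> bool" where
  "reception_compatible \<Lambda> \<longleftrightarrow>
    (\<forall>B M. finite B \<and> B \<subseteq> lang \<Lambda> \<and> M \<subseteq> models \<Lambda> \<longrightarrow> FRsups (Mod \<Lambda> B \<union> M) \<Lambda> \<noteq> {})"

datatype truth = Fls | Unk | Tru

instantiation truth :: linorder
begin

fun less_truth :: "truth \<Rightarrow> truth \<Rightarrow> bool" where
  "Fls < Unk = True"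
| "Fls < Tru = True"
| "Unk < Tru = True"
| "(_ :: truth) < _ = False"

definition less_eq_truth :: "truth \<Rightarrow> truth \<Rightarrow> bool" where
  "less_eq_truth x y \<longleftrightarrow> x < y \<or> x = y"

instance
proof
  fix x y z :: truth
  show "x < y \<longleftrightarrow> x \<le> y \<and> \<not> y \<le> x"
    by (cases x; cases y) (simp_all add: less_eq_truth_def)
  show "x \<le> x"
    by (simp add: less_eq_truth_def)
  show "x \<le> y \<Longrightarrow> y \<le> z \<Longrightarrow> x \<le> z"
    by (cases x; cases y; cases z) (simp_all add: less_eq_truth_def)
  show "x \<le> y \<Longrightarrow> y \<le> x \<Longrightarrow> x = y"
    by (cases x; cases y) (simp_all add: less_eq_truth_def)
  show "x \<le> y \<or> y \<le> x"
    by (cases x; cases y) (simp_all add: less_eq_truth_def)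
qed

end

datatype 'p form =
    Atom 'p
  | Neg "'p form"
  | And "'p form" "'p form"
  | Or "'p form" "'p form"

fun neg3 :: "truth \<Rightarrow> truth" where
  "neg3 Fls = Tru"
| "neg3 Unk = Unk"
| "neg3 Tru = Fls"

definition M3 :: "('p form \<Rightarrow> truth) set" where
  "M3 = {v. (\<forall>\<phi>. v (Neg \<phi>) = neg3 (v \<phi>)) \<and>
            (\<forall>\<phi> \<psi>. v (And \<phi> \<psi>) = min (v \<phi>) (v \<psi>)) \<and>
            (\<forall>\<phi> \<psi>. v (Or \<phi> \<psi>) = max (v \<phi>) (v \<psi>))}"

text \<open>
  The finite set of atoms is the universe of the type \<open>'p\<close>, so it is also nonempty.
  This matters: without atoms there would be no formulas, \<open>FR\<close> would not contain
  the empty set, and eviction would fail for K3.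
\<close>

definition K3 :: "('p::finite form, 'p form \<Rightarrow> truth) satsys" where
  "K3 = \<lparr>lang = UNIV, models = M3, satisfies = (\<lambda>v B. \<forall>\<phi>\<in>B. v \<phi> = Tru)\<rparr>"

definition P3 :: "('p::finite form, 'p form \<Rightarrow> truth) satsys" where
  "P3 = \<lparr>lang = UNIV, models = M3, satisfies = (\<lambda>v B. \<forall>\<phi>\<in>B. v \<phi> \<in> {Tru, Unk})\<rparr>"

end

(* Over finitely many atoms there are only finitely many three-valued models, so minimal or
   maximal elements of a set of model classes exist as soon as the set is nonempty. Reception
   always has the candidate Mod {}, the class of all models. For eviction, K3 has the candidate
   Mod {p & ~p} = {}, whereas in P3 the valuation that is unknown everywhere satisfies every
   set of formulas, so no model class lies inside the empty set. *)
theory Submission imports Defs begin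

lemma finite_FR:
  assumes "finite (models \<Lambda>)"
  shows "finite (FR \<Lambda>)"
proof (rule finite_subset)
  show "FR \<Lambda> \<subseteq> Pow (models \<Lambda>)"
    by (auto simp: FR_def Mod_def)
  show "finite (Pow (models \<Lambda>))"
    using assms by simp
qed

lemma FRsubs_nonempty:
  assumes "finite (models \<Lambda>)" "X \<in> FR \<Lambda>" "X \<subseteq> M"
  shows "FRsubs M \<Lambda> \<noteq> {}"
proof -
  have "finite {X \<in> FR \<Lambda>. X \<subseteq> M}" "{X \<in> FR \<Lambda>. X \<subseteq> M} \<noteq> {}"
    using finite_FR[OF assms(1)] assms by auto
  from finite_has_maximal[OF this] obtain Y
    where "Y \<in> FR \<Lambda>" "Y \<subseteq> M" "\<And>Z. Z \<in> FR \<Lambda> \<Longrightarrow> Z \<subseteq> M \<Longrightarrow> Y \<subseteq> Z \<Longrightarrow> Y = Z"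
    by (metis (no_types, lifting) mem_Collect_eq)
  then have "Y \<in> FRsubs M \<Lambda>"
    by (auto simp: FRsubs_def psubset_eq)
  then show ?thesis
    by auto
qed

lemma FRsups_nonempty:
  assumes "finite (models \<Lambda>)" "X \<in> FR \<Lambda>" "M \<subseteq> X"
  shows "FRsups M \<Lambda> \<noteq> {}"
proof -
  have "finite {X \<in> FR \<Lambda>. M \<subseteq> X}" "{X \<in> FR \<Lambda>. M \<subseteq> X} \<noteq> {}"
    using finite_FR[OF assms(1)] assms by auto
  from finite_has_minimal[OF this] obtain Y
    where "Y \<in> FR \<Lambda>" "M \<subseteq> Y" "\<And>Z. Z \<in> FR \<Lambda> \<Longrightarrow> M \<subseteq> Z \<Longrightarrow> Z \<subseteq> Y \<Longrightarrow> Y = Z"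
    by (metis (no_types, lifting) mem_Collect_eq)
  then have "Y \<in> FRsups M \<Lambda>"
    by (auto simp: FRsups_def psubset_eq)
  then show ?thesis
    by auto
qed

text \<open>The class of all models contains every set \<open>Mod \<Lambda> B \<union> M\<close>, so
  one candidate serves all instances at once.\<close>

lemma reception_compatibleI:
  assumes "finite (models \<Lambda>)" "models \<Lambda> \<in> FR \<Lambda>"
  shows "reception_compatible \<Lambda>"
  unfolding reception_compatible_def
  using FRsups_nonempty[OF assms] by (auto simp: Mod_def)

text \<open>Dually, the empty class lies inside every difference
  \<open>Mod \<Lambda> B - M\<close>.\<close>

lemma eviction_compatibleI:
  assumes "finite (models \<Lambda>)" "{} \<in> FR \<Lambda>"
  shows "eviction_compatible \<Lambda>"
  unfolding eviction_compatible_def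
  using FRsubs_nonempty[OF assms] by blast

instance truth :: finite
proof
  have "UNIV = {Fls, Unk, Tru}"
    using truth.exhaust by auto
  then show "finite (UNIV :: truth set)"
    by (metis finite.emptyI finite_insert)
qed

text \<open>The connectives are truth-functional, so induction on the formula carries agreement on
  atoms to all formulas.\<close>

lemma M3_eqI:
  assumes "v \<in> M3" "w \<in> M3" "\<And>p. v (Atom p) = w (Atom p)"
  shows "v = w"
proof
  fix \<phi>
  show "v \<phi> = w \<phi>"
    using assms by (induction \<phi>) (simp_all add: M3_def)
qed

lemma finite_M3: "finite (M3 :: ('p::finite form \<Rightarrow> truth) set)"
proof (rule finite_imageD)
  \<comment> \<open>There are infinitely many formulas, but the restrictions to atoms live in
    \<open>'p \<Rightarrow> truth\<close>, a finite type because \<open>'p\<close> and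
    \<open>truth\<close> are finite.\<close>
  show "finite ((\<lambda>v p. v (Atom p)) ` (M3 :: ('p form \<Rightarrow> truth) set))"
    by simp
  show "inj_on (\<lambda>v p. v (Atom p)) (M3 :: ('p form \<Rightarrow> truth) set)"
    by (intro inj_onI M3_eqI) (auto dest: fun_cong)
qed

text \<open>\<open>Unk\<close> is fixed by \<open>neg3\<close>, and \<open>min\<close> and
  \<open>max\<close> are idempotent.\<close>

lemma all_unknown_in_M3: "(\<lambda>_. Unk) \<in> M3"
  by (simp add: M3_def)

text \<open>For the minimum to be \<open>Tru\<close>, both \<open>x\<close> and
  \<open>neg3 x\<close> would have to be \<open>Tru\<close>.\<close>

lemma Mod_K3_contradiction: "Mod K3 {And \<phi> (Neg \<phi>)} = {}"
proof -
  have "min x (neg3 x) \<noteq> Tru" for x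
    by (cases x) (simp_all add: min_def less_eq_truth_def)
  then show ?thesis
    by (auto simp: Mod_def K3_def M3_def)
qed

theorem theorem6:
  shows "reception_compatible (K3 :: ('p::finite form, 'p form \<Rightarrow> truth) satsys) \<and>
    reception_compatible (P3 :: ('p form, 'p form \<Rightarrow> truth) satsys) \<and>
    eviction_compatible (K3 :: ('p form, 'p form \<Rightarrow> truth) satsys) \<and>
    \<not> eviction_compatible (P3 :: ('p form, 'p form \<Rightarrow> truth) satsys)"
proof (intro conjI)
  let ?K = "K3 :: ('p form, 'p form \<Rightarrow> truth) satsys"
  let ?P = "P3 :: ('p form, 'p form \<Rightarrow> truth) satsys"
  have fin: "finite (models ?K)" "finite (models ?P)"
    using finite_M3 by (simp_all add: K3_def P3_def)
  have "models ?K = Mod ?K {}" "models ?P = Mod ?P {}"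
    by (simp_all add: Mod_def K3_def P3_def)
  then have "models ?K \<in> FR ?K" "models ?P \<in> FR ?P"
    unfolding FR_def by blast+
  with fin show "reception_compatible ?K" "reception_compatible ?P"
    by (simp_all add: reception_compatibleI)
  \<comment> \<open>Any atom would do; \<open>undefined\<close> names one, since types are
    nonempty.\<close>
  have "Mod ?K {And (Atom undefined) (Neg (Atom undefined))} \<in> FR ?K"
    unfolding FR_def by (force simp: K3_def)
  with fin show "eviction_compatible ?K"
    by (simp add: Mod_K3_contradiction eviction_compatibleI)
  have "(\<lambda>_. Unk) \<in> X" if "X \<in> FR ?P" for X
    using that all_unknown_in_M3 by (auto simp: FR_def Mod_def P3_def)
  \<comment> \<open>Removing all models from \<open>Mod ?P {}\<close> leaves the empty set, which
    cannot include a class containing the all-unknown valuation.\<close>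
  then have "FRsubs (Mod ?P {} - models ?P) ?P = {}"
    by (auto simp: FRsubs_def Mod_def)
  then show "\<not> eviction_compatible ?P"
    unfolding eviction_compatible_def by blast
qed

end
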